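(* Let $m,n$ be positive integers and let $\mathcal{O}$ be any orbit of the reverse operator $\Psi$ on the set of antichains of the poset $[m]\times K_{n-1}$. Then the average size of the antichains in $\mathcal{O}$ is $$\frac{1}{|\mathcal{O}|}\sum_{A\in\mathcal{O}}|A|=\frac{2mn}{m+2n-1}.$$
   Context: $[k]=\{1<2<\dots<k\}$ is the $k$-element chain (and $[0]$ is the empty poset). $K_{r}:=[r]\oplus([1]\sqcup[1])\oplus[r]$, where $\oplus$ is ordinal sum and $\sqcup$ is disjoint union; thus $K_{n-1}$ has $2n$ elements $1<\dots<n-1<\{n,n'\}<n+1<\dots<2n-1$, with $n$ and $n'$ incomparable. Products of posets carry the componentwise order. For a finite poset $P$, an ideal is a down-closed subset and an antichain is a subset of mutually incomparable elements. For an antichain $A$ let $I(A)=\{y\in P: y\le a\text{ for some }a\in A\}$. The reverse operator is the bijection on antichains $\Psi(A)=\min(P\setminus I(A))$, the set of minimal elements of $P\setminus I(A)$. An orbit is an orbit of the cyclic group generated by $\Psi$. *)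

theory Defs
  imports Complex_Main "HOL-Algebra.Group_Action" "HOL-Algebra.Multiplicative_Group"
begin

text \<open>
  A poset is a reflexive, antisymmetric and transitive relation \<open>r\<close> on its carrier
  \<^term>\<open>Field r\<close>, with \<open>(x, y) \<in> r\<close> meaning \<open>x \<le> y\<close>.
\<close>

definition chain_order :: "nat \<Rightarrow> nat rel" where
  "chain_order k = {(i, j). 1 \<le> i \<and> i \<le> j \<and> j \<le> k}"

definition disjoint_sum :: "'a rel \<Rightarrow> 'b rel \<Rightarrow> ('a + 'b) rel" where
  "disjoint_sum r s = {(Inl a, Inl b) | a b. (a, b) \<in> r} \<union> {(Inr a, Inr b) | a b. (a, b) \<in> s}"

definition ordinal_sum :: "'a rel \<Rightarrow> 'b rel \<Rightarrow> ('a + 'b) rel" where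
  "ordinal_sum r s = disjoint_sum r s \<union> (Inl ` Field r) \<times> (Inr ` Field s)"

definition prod_order :: "'a rel \<Rightarrow> 'b rel \<Rightarrow> ('a \<times> 'b) rel" where
  "prod_order r s = {((a, b), (a', b')) | a b a' b'. (a, a') \<in> r \<and> (b, b') \<in> s}"

definition K_order :: "nat \<Rightarrow> (nat + ((nat + nat) + nat)) rel" where
  "K_order r = ordinal_sum (chain_order r)
     (ordinal_sum (disjoint_sum (chain_order 1) (chain_order 1)) (chain_order r))"

definition antichains :: "'a rel \<Rightarrow> 'a set set" where
  "antichains r = {A. A \<subseteq> Field r \<and> (\<forall>x\<in>A. \<forall>y\<in>A. x \<noteq> y \<longrightarrow> (x, y) \<notin> r)}"

definition generated_ideal :: "'a rel \<Rightarrow> 'a set \<Rightarrow> 'a set" where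
  "generated_ideal r A = {y \<in> Field r. \<exists>a\<in>A. (y, a) \<in> r}"

definition minimals :: "'a rel \<Rightarrow> 'a set \<Rightarrow> 'a set" where
  "minimals r S = {x \<in> S. \<forall>y\<in>S. (y, x) \<in> r \<longrightarrow> y = x}"

definition reverse_op :: "'a rel \<Rightarrow> 'a set \<Rightarrow> 'a set" where
  "reverse_op r A = minimals r (Field r - generated_ideal r A)"

text \<open>
  The orbits on \<open>S\<close> of the cyclic group generated by a bijection \<open>f\<close> of \<open>S\<close>. The restriction
  is needed because the elements of \<^term>\<open>BijGroup S\<close> are extensional functions on \<open>S\<close>;
  the generated group acts on \<open>S\<close> by application. If \<open>f\<close> were not a bijection of \<open>S\<close>,
  \<^const>\<open>subgroup_generated\<close> would discard it; see \<open>reverse_op_bij\<close> below.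
\<close>

definition cyclic_orbits :: "('a \<Rightarrow> 'a) \<Rightarrow> 'a set \<Rightarrow> 'a set set" where
  "cyclic_orbits f S = orbits (subgroup_generated (BijGroup S) {restrict f S}) S (\<lambda>g. g)"

lemma Field_chain_order: "Field (chain_order k) = {1..k}"
  by (force simp: Field_def chain_order_def)

lemma Field_disjoint_sum: "Field (disjoint_sum r s) = Inl ` Field r \<union> Inr ` Field s"
  by (force simp: Field_def disjoint_sum_def)

lemma Field_ordinal_sum: "Field (ordinal_sum r s) = Inl ` Field r \<union> Inr ` Field s"
proof -
  have "Field (X \<union> Y) = Field X" if "Field Y \<subseteq> Field X" for X Y :: "'c rel"
    using that by (auto simp: Field_Un)
  moreover have "Field (Inl ` Field r \<times> Inr ` Field s) \<subseteq> Field (disjoint_sum r s)"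
    unfolding Field_disjoint_sum by (auto simp: Field_def)
  ultimately show ?thesis
    unfolding ordinal_sum_def Field_disjoint_sum[symmetric] by blast
qed

lemma Field_prod_order:
  assumes "Refl r" "Refl s"
  shows "Field (prod_order r s) = Field r \<times> Field s"
proof
  show "Field (prod_order r s) \<subseteq> Field r \<times> Field s"
    by (auto simp: Field_def prod_order_def)
  show "Field r \<times> Field s \<subseteq> Field (prod_order r s)"
  proof
    fix x assume "x \<in> Field r \<times> Field s"
    then have "(x, x) \<in> prod_order r s"
      using assms by (auto simp: prod_order_def refl_on_def)
    then show "x \<in> Field (prod_order r s)" by (rule FieldI1)
  qed
qed

lemma Partial_order_iff:
  "Partial_order r \<longleftrightarrow> (\<forall>x\<in>Field r. (x, x) \<in> r) \<and> antisym r \<and> trans r"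
  by (auto simp: partial_order_on_def preorder_on_def refl_on_def intro: FieldI1 FieldI2)

lemma Partial_order_chain_order: "Partial_order (chain_order k)"
  unfolding Partial_order_iff unfolding Field_chain_order
  by (auto simp: chain_order_def antisym_def trans_def)

lemma disjoint_sum_simps [simp]:
  "(Inl a, Inl a') \<in> disjoint_sum r s \<longleftrightarrow> (a, a') \<in> r"
  "(Inr b, Inr b') \<in> disjoint_sum r s \<longleftrightarrow> (b, b') \<in> s"
  "(Inl a, Inr b) \<notin> disjoint_sum r s"
  "(Inr b, Inl a) \<notin> disjoint_sum r s"
  by (auto simp: disjoint_sum_def)

lemma Partial_order_disjoint_sum:
  assumes "Partial_order r" "Partial_order s"
  shows "Partial_order (disjoint_sum r s)"
  unfolding Partial_order_iff
proof (intro conjI)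
  have r: "\<forall>x\<in>Field r. (x, x) \<in> r" "antisym r" "trans r"
    and s: "\<forall>x\<in>Field s. (x, x) \<in> s" "antisym s" "trans s"
    using assms by (simp_all add: Partial_order_iff)
  show "\<forall>x\<in>Field (disjoint_sum r s). (x, x) \<in> disjoint_sum r s"
    using r s by (auto simp: Field_disjoint_sum)
  show "antisym (disjoint_sum r s)"
  proof (rule antisymI)
    fix x y assume "(x, y) \<in> disjoint_sum r s" "(y, x) \<in> disjoint_sum r s"
    then show "x = y"
      by (cases x; cases y) (auto intro: antisymD[OF r(2)] antisymD[OF s(2)])
  qed
  show "trans (disjoint_sum r s)"
  proof (rule transI)
    fix x y z assume "(x, y) \<in> disjoint_sum r s" "(y, z) \<in> disjoint_sum r s"
    then show "(x, z) \<in> disjoint_sum r s"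
      by (cases x; cases y; cases z) (auto intro: transD[OF r(3)] transD[OF s(3)])
  qed
qed

lemma ordinal_sum_simps [simp]:
  "(Inl a, Inl a') \<in> ordinal_sum r s \<longleftrightarrow> (a, a') \<in> r"
  "(Inr b, Inr b') \<in> ordinal_sum r s \<longleftrightarrow> (b, b') \<in> s"
  "(Inl a, Inr b) \<in> ordinal_sum r s \<longleftrightarrow> a \<in> Field r \<and> b \<in> Field s"
  "(Inr b, Inl a) \<notin> ordinal_sum r s"
  by (auto simp: ordinal_sum_def disjoint_sum_def)

lemma Partial_order_ordinal_sum:
  assumes "Partial_order r" "Partial_order s"
  shows "Partial_order (ordinal_sum r s)"
  unfolding Partial_order_iff
proof (intro conjI)
  have r: "\<forall>x\<in>Field r. (x, x) \<in> r" "antisym r" "trans r"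
    and s: "\<forall>x\<in>Field s. (x, x) \<in> s" "antisym s" "trans s"
    using assms by (simp_all add: Partial_order_iff)
  show "\<forall>x\<in>Field (ordinal_sum r s). (x, x) \<in> ordinal_sum r s"
    using r s by (auto simp: Field_ordinal_sum)
  show "antisym (ordinal_sum r s)"
  proof (rule antisymI)
    fix x y assume "(x, y) \<in> ordinal_sum r s" "(y, x) \<in> ordinal_sum r s"
    then show "x = y"
      using antisymD[OF r(2)] antisymD[OF s(2)] by (cases x; cases y) simp_all
  qed
  show "trans (ordinal_sum r s)"
  proof (rule transI)
    fix x y z assume "(x, y) \<in> ordinal_sum r s" "(y, z) \<in> ordinal_sum r s"
    then show "(x, z) \<in> ordinal_sum r s"
      by (cases x; cases y; cases z)
        (auto intro: FieldI1 FieldI2 transD[OF r(3)] transD[OF s(3)])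
  qed
qed

lemma prod_order_iff [simp]:
  "((a, b), (a', b')) \<in> prod_order r s \<longleftrightarrow> (a, a') \<in> r \<and> (b, b') \<in> s"
  by (simp add: prod_order_def)

lemma Partial_order_prod_order:
  assumes "Partial_order r" "Partial_order s"
  shows "Partial_order (prod_order r s)"
  unfolding Partial_order_iff
proof (intro conjI)
  have r: "\<forall>x\<in>Field r. (x, x) \<in> r" "antisym r" "trans r"
    and s: "\<forall>x\<in>Field s. (x, x) \<in> s" "antisym s" "trans s"
    using assms by (simp_all add: Partial_order_iff)
  have "Refl r" "Refl s"
    using assms by (simp_all add: partial_order_on_def preorder_on_def)
  then show "\<forall>x\<in>Field (prod_order r s). (x, x) \<in> prod_order r s"
    using r s by (auto simp: Field_prod_order)
  show "antisym (prod_order r s)"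
  proof (rule antisymI)
    fix x y assume "(x, y) \<in> prod_order r s" "(y, x) \<in> prod_order r s"
    then show "x = y"
      by (cases x; cases y) (auto intro: antisymD[OF r(2)] antisymD[OF s(2)])
  qed
  show "trans (prod_order r s)"
  proof (rule transI)
    fix x y z assume "(x, y) \<in> prod_order r s" "(y, z) \<in> prod_order r s"
    then show "(x, z) \<in> prod_order r s"
      by (cases x; cases y; cases z) (auto intro: transD[OF r(3)] transD[OF s(3)])
  qed
qed

lemma Partial_order_K_order: "Partial_order (K_order r)"
  unfolding K_order_def
  by (intro Partial_order_ordinal_sum Partial_order_disjoint_sum Partial_order_chain_order)

lemma finite_Field_K_order: "finite (Field (K_order r))"
  by (simp add: K_order_def Field_ordinal_sum Field_disjoint_sum Field_chain_order)

lemma card_Field_K_order: "card (Field (K_order r)) = 2 * r + 2"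
proof -
  have "Field (K_order r) =
      {1..r} <+> (({1..1} <+> {1..1}) <+> {1..r})"
    by (simp add: K_order_def Field_ordinal_sum Field_disjoint_sum Field_chain_order Plus_def)
  then show ?thesis by (simp add: card_Plus)
qed

lemma finite_antichains:
  assumes "finite (Field r)" shows "finite (antichains r)"
proof (rule finite_subset)
  show "antichains r \<subseteq> Pow (Field r)" by (auto simp: antichains_def)
  show "finite (Pow (Field r))" using assms by simp
qed

text \<open>The reverse operator is a bijection on the antichains of a finite poset.\<close>

lemma ex_minimal_below:
  assumes "Partial_order r" "finite S" "x \<in> S" "S \<subseteq> Field r"
  shows "\<exists>y\<in>minimals r S. (y, x) \<in> r"
  using assms(3)
proof (induction "card {z \<in> S. (z, x) \<in> r}" arbitrary: x rule: less_induct)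
  case less
  have refl: "(x, x) \<in> r" using less.prems assms by (auto simp: Partial_order_iff)
  show ?case
  proof (cases "x \<in> minimals r S")
    case True
    then show ?thesis using refl by blast
  next
    case False
    then obtain y where y: "y \<in> S" "(y, x) \<in> r" "y \<noteq> x"
      using less.prems by (auto simp: minimals_def)
    have "(x, y) \<notin> r" using y assms(1) by (auto simp: Partial_order_iff antisym_def)
    moreover have tr: "(z, x) \<in> r" if "(z, y) \<in> r" for z
      using that y assms(1) by (meson Partial_order_iff transD)
    ultimately have "{z \<in> S. (z, y) \<in> r} \<subset> {z \<in> S. (z, x) \<in> r}"
      using less.prems refl by blast
    then have "card {z \<in> S. (z, y) \<in> r} < card {z \<in> S. (z, x) \<in> r}"
      using assms(2) by (intro psubset_card_mono) auto
    from less.hyps[OF this y(1)] tr show ?thesis by blast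
  qed
qed

lemma reverse_op_antichain: "reverse_op r A \<in> antichains r"
  by (auto simp: reverse_op_def minimals_def antichains_def)

lemma antichain_subset_of_ideal_eq:
  assumes "Partial_order r" "A \<in> antichains r" "B \<in> antichains r"
    and eq: "generated_ideal r A = generated_ideal r B"
  shows "A \<subseteq> B"
proof
  fix x assume x: "x \<in> A"
  have AB: "A \<subseteq> Field r" "B \<subseteq> Field r" using assms by (auto simp: antichains_def)
  have sub: "A \<subseteq> generated_ideal r A" "B \<subseteq> generated_ideal r B"
    using assms(1) AB by (auto simp: generated_ideal_def Partial_order_iff)
  obtain b where b: "b \<in> B" "(x, b) \<in> r"
    using x sub eq unfolding generated_ideal_def by blast
  obtain a where a: "a \<in> A" "(b, a) \<in> r"
    using b sub eq unfolding generated_ideal_def by blast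
  have "(x, a) \<in> r" using a b assms(1) by (meson Partial_order_iff transD)
  then have "x = a" using x a assms(2) by (auto simp: antichains_def)
  then have "x = b" using a b assms(1) by (auto simp: Partial_order_iff antisym_def)
  then show "x \<in> B" using b by simp
qed

lemma generated_ideal_complement:
  assumes "Partial_order r" "finite (Field r)"
  shows "Field r - generated_ideal r A = {x \<in> Field r. \<exists>y\<in>reverse_op r A. (y, x) \<in> r}"
    (is "?L = ?R")
proof
  show "?L \<subseteq> ?R"
    using ex_minimal_below[OF assms(1), of ?L] assms(2) by (auto simp: reverse_op_def)
  show "?R \<subseteq> ?L"
  proof
    fix x assume "x \<in> ?R"
    then obtain y where y: "x \<in> Field r" "y \<in> reverse_op r A" "(y, x) \<in> r" by blast
    have "y \<in> ?L" using y by (auto simp: reverse_op_def minimals_def)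
    moreover have "y \<in> generated_ideal r A" if x: "x \<in> generated_ideal r A"
    proof -
      obtain a where "a \<in> A" "(x, a) \<in> r" using x by (auto simp: generated_ideal_def)
      then have "(y, a) \<in> r" using y assms(1) by (meson Partial_order_iff transD)
      then show ?thesis using \<open>a \<in> A\<close> by (auto simp: generated_ideal_def intro: FieldI1)
    qed
    ultimately show "x \<in> ?L" using y by blast
  qed
qed

lemma reverse_op_bij:
  assumes "Partial_order r" "finite (Field r)"
  shows "bij_betw (reverse_op r) (antichains r) (antichains r)"
proof -
  have "inj_on (reverse_op r) (antichains r)"
  proof (rule inj_onI)
    fix A B assume AB: "A \<in> antichains r" "B \<in> antichains r" "reverse_op r A = reverse_op r B"
    have "Field r - generated_ideal r A = Field r - generated_ideal r B"
      unfolding generated_ideal_complement[OF assms] AB(3) ..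
    then have "generated_ideal r A = generated_ideal r B"
      by (auto simp: generated_ideal_def)
    then show "A = B"
      using antichain_subset_of_ideal_eq[OF assms(1)] AB by (metis subset_antisym)
  qed
  moreover have "reverse_op r ` antichains r \<subseteq> antichains r"
    using reverse_op_antichain by blast
  ultimately show ?thesis
    using endo_inj_surj[OF finite_antichains[OF assms(2)]] by (simp add: bij_betw_def)
qed

text \<open>For a bijection of a finite set, the orbits consist of the forward iterates.\<close>

lemma BijGroup_pow:
  fixes k :: nat
  assumes "f \<in> Bij S" "x \<in> S"
  shows "(f [^]\<^bsub>BijGroup S\<^esub> k) x = (f ^^ k) x"
  using assms(2)
proof (induction k arbitrary: x)
  case 0
  then show ?case by (simp add: BijGroup_def)
next
  case (Suc k)
  interpret group "BijGroup S" by (rule group_BijGroup)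
  have car: "carrier (BijGroup S) = Bij S"
    by (simp add: BijGroup_def)
  have pow: "f [^]\<^bsub>BijGroup S\<^esub> k \<in> Bij S"
    using nat_pow_closed[of f k] assms(1) unfolding car .
  have "f [^]\<^bsub>BijGroup S\<^esub> Suc k = f [^]\<^bsub>BijGroup S\<^esub> k \<otimes>\<^bsub>BijGroup S\<^esub> f"
    by (rule nat_pow_Suc)
  also have "\<dots> = compose S (f [^]\<^bsub>BijGroup S\<^esub> k) f"
    using pow assms(1) by (simp only: BijGroup_def monoid.simps restrict_apply' if_True)
  finally have "(f [^]\<^bsub>BijGroup S\<^esub> Suc k) x = (f [^]\<^bsub>BijGroup S\<^esub> k) (f x)"
    using Suc.prems by (simp only: compose_eq)
  also have "\<dots> = (f ^^ k) (f x)"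
    using Suc assms(1) Bij_imp_funcset by blast
  finally show ?case by (simp add: funpow_swap1)
qed

lemma cyclic_orbits_eq_iterates:
  assumes "finite S" "bij_betw f S S"
  shows "cyclic_orbits f S = {{(f ^^ k) x | k. True} | x. x \<in> S}"
proof -
  let ?f = "restrict f S"
  interpret group "BijGroup S" by (rule group_BijGroup)
  have fB: "?f \<in> Bij S"
    using assms(2) by (auto simp: Bij_def cong: bij_betw_cong)
  then have fc: "?f \<in> carrier (BijGroup S)" by (simp add: BijGroup_def)
  have "Bij S \<subseteq> S \<rightarrow>\<^sub>E S"
    by (auto simp: PiE_def Bij_imp_extensional dest: Bij_imp_funcset)
  then have fin: "finite (carrier (BijGroup S))"
    using finite_PiE[OF assms(1), of "\<lambda>_. S"] assms(1)
    by (simp add: BijGroup_def finite_subset)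
  have car: "carrier (subgroup_generated (BijGroup S) {?f}) =
      {?f [^]\<^bsub>BijGroup S\<^esub> k | k. k \<in> (UNIV :: nat set)}"
    using generate_pow_on_finite_carrier[OF fin fc] fc
    by (simp add: carrier_subgroup_generated)
  have it: "(?f ^^ k) x = (f ^^ k) x" if "x \<in> S" for k x
  proof -
    have "(f ^^ k) x \<in> S \<and> (?f ^^ k) x = (f ^^ k) x"
      using that assms(2) by (induction k) (auto simp: bij_betw_def)
    then show ?thesis ..
  qed
  have "orbit (subgroup_generated (BijGroup S) {?f}) (\<lambda>g. g) x = {(f ^^ k) x | k. True}"
    if "x \<in> S" for x
    unfolding orbit_def car using BijGroup_pow[OF fB that] it[OF that] by auto metis
  then show ?thesis
    unfolding cyclic_orbits_def orbits_def by (metis (no_types, lifting))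
qed

end

theory Submission
  imports Defs
begin

text \<open>
  Describe an antichain \<open>A\<close> by the height of its ideal in each fibre \<open>[m] \<times> {x}\<close>. A row \<open>i \<ge> 1\<close> meets
  \<open>A\<close> iff \<open>i\<close> is a height, and row \<open>i + 1\<close> meets \<open>\<Psi>(A)\<close> iff \<open>i\<close> is a height; all of level \<open>j\<close> of
  \<open>K\<^bsub>n-1\<^esub>\<close> is hit by \<open>A\<close> iff all heights strictly drop from level \<open>j\<close> to \<open>j + 1\<close>, iff all of level
  \<open>j + 1\<close> is hit by \<open>\<Psi>(A)\<close>. So \<open>\<Psi>\<close> shifts occupied rows and fully occupied levels, and level \<open>1\<close> is
  fully hit by \<open>\<Psi>(A)\<close> iff row \<open>m\<close> does not meet \<open>A\<close>. Hence in an orbit \<open>\<O>\<close> every row is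
  occupied \<open>R\<close> times and every level is fully occupied \<open>|\<O>| - R\<close> times. Whether the two middle
  heights agree is invariant under \<open>\<Psi>\<close>. If they do, \<open>A\<close> has as many occupied rows as full levels,
  and \<open>|A|\<close> is that number, plus one if the middle level is full; if not, \<open>|A|\<close> is the number of
  occupied rows and exceeds that of full levels by one. In both cases this determines \<open>R\<close> and the
  sum of the \<open>|A|\<close>.
\<close>

section \<open>Double counting and orbits of a bijection\<close>

declare prod_order_iff [simp del]

lemma Refl_if_Partial_order: "Partial_order r \<Longrightarrow> Refl r"
  by (simp add: partial_order_on_def preorder_on_def)

lemma sum_card_eq_card_Collect:
  assumes "finite S" "finite J"
  shows "(\<Sum>x\<in>S. card {j \<in> J. Q j x}) = (\<Sum>j\<in>J. card {x \<in> S. Q j x})"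
proof -
  have "(\<Sum>x\<in>S. card {j \<in> J. Q j x}) = (\<Sum>x\<in>S. \<Sum>j\<in>J. if Q j x then 1 else 0)"
    using assms(2) by (simp add: sum.If_cases Int_def)
  also have "\<dots> = (\<Sum>j\<in>J. \<Sum>x\<in>S. if Q j x then 1 else 0)"
    by (rule sum.swap)
  also have "\<dots> = (\<Sum>j\<in>J. card {x \<in> S. Q j x})"
    using assms(1) by (simp add: sum.If_cases Int_def)
  finally show ?thesis .
qed

text \<open>The map \<open>f\<close> carries the points with \<open>Q'\<close> bijectively onto
  those with \<open>Q\<close>. Along an orbit this transports counts through one application of
  \<open>reverse_op\<close>.\<close>

lemma card_Collect_bij_betw:
  assumes "bij_betw f S S" "\<And>x. x \<in> S \<Longrightarrow> Q (f x) \<longleftrightarrow> Q' x"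
  shows "card {x \<in> S. Q x} = card {x \<in> S. Q' x}"
proof -
  have f: "inj_on f S" "f ` S = S" using assms(1) by (simp_all add: bij_betw_def)
  have "{x \<in> S. Q x} = f ` {x \<in> S. Q' x}"
  proof
    show "{x \<in> S. Q x} \<subseteq> f ` {x \<in> S. Q' x}"
    proof
      fix y assume "y \<in> {x \<in> S. Q x}"
      then obtain x where "x \<in> S" "y = f x" "Q y" using f(2) by blast
      then show "y \<in> f ` {x \<in> S. Q' x}" using assms(2)[of x] by blast
    qed
    show "f ` {x \<in> S. Q' x} \<subseteq> {x \<in> S. Q x}" using assms(2) f(2) by auto
  qed
  moreover have "inj_on f {x \<in> S. Q' x}" using f(1) by (rule inj_on_subset) simp
  ultimately show ?thesis by (simp add: card_image)
qed

text \<open>An orbit consists of the forward iterates of one point, so \<open>f\<close> maps it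
  injectively into itself and, by finiteness, onto itself. An invariant predicate keeps its truth
  value along the iterates.\<close>

lemma cyclic_orbit_properties:
  assumes "finite S" "bij_betw f S S" "\<O> \<in> cyclic_orbits f S"
  shows "\<O> \<subseteq> S" "\<O> \<noteq> {}" "bij_betw f \<O> \<O>"
    and "\<And>x. x \<in> \<O> \<Longrightarrow> (\<And>y. y \<in> S \<Longrightarrow> Q (f y) \<longleftrightarrow> Q y) \<Longrightarrow> \<forall>y\<in>\<O>. Q y \<longleftrightarrow> Q x"
proof -
  from assms obtain x where x: "x \<in> S" "\<O> = {(f ^^ k) x | k. True}"
    by (auto simp: cyclic_orbits_eq_iterates)
  have closed: "(f ^^ k) x \<in> S" for k
    using x assms(2) by (induction k) (auto simp: bij_betw_def)
  then show sub: "\<O> \<subseteq> S" using x by auto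
  show "\<O> \<noteq> {}" using x by auto
  have "f ` \<O> \<subseteq> \<O>"
  proof
    fix y assume "y \<in> f ` \<O>"
    then obtain k where "y = (f ^^ Suc k) x" using x by auto
    then show "y \<in> \<O>" using x by blast
  qed
  moreover have "inj_on f \<O>"
    using assms(2) sub by (auto simp: bij_betw_def intro: inj_on_subset)
  moreover have "finite \<O>" using sub assms(1) finite_subset by blast
  ultimately show "bij_betw f \<O> \<O>"
    by (simp add: bij_betw_def endo_inj_surj)
  fix y assume y: "y \<in> \<O>" and Q: "\<And>y. y \<in> S \<Longrightarrow> Q (f y) \<longleftrightarrow> Q y"
  have "Q ((f ^^ k) x) \<longleftrightarrow> Q x" for k
    using Q closed by (induction k) auto
  then show "\<forall>z\<in>\<O>. Q z \<longleftrightarrow> Q y" using x y by auto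
qed

section \<open>Products of a chain with an ordinal sum of antichains\<close>

text \<open>\<open>lev_image\<close> makes every level nonempty. Keeping the level sizes open lets
  the shift of rows and levels be proved before the doubled level enters.\<close>

locale layered_order =
  fixes m N :: nat and r :: "'a rel" and lev :: "'a \<Rightarrow> nat"
  assumes m: "m \<ge> 1" and N: "N \<ge> 1"
    and finite_Field: "finite (Field r)"
    and lev_image: "lev ` Field r = {1..N}"
    and r_iff: "\<And>x y. (x, y) \<in> r \<longleftrightarrow> x \<in> Field r \<and> y \<in> Field r \<and> (x = y \<or> lev x < lev y)"
begin

abbreviation P :: "(nat \<times> 'a) rel" where
  "P \<equiv> prod_order (chain_order m) r"

text \<open>The ideal meets a fibre in an initial segment, so its cardinality is the top row
  reached, with \<open>0\<close> for an empty fibre.\<close>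

definition height :: "(nat \<times> 'a) set \<Rightarrow> 'a \<Rightarrow> nat" where
  "height A x = card {i. (i, x) \<in> generated_ideal P A}"

text \<open>This is vacuously true for \<open>j\<close> outside \<open>{1..N}\<close>; counts of
  full levels are therefore restricted to that range.\<close>

definition full :: "(nat \<times> 'a) set \<Rightarrow> nat \<Rightarrow> bool" where
  "full A j \<longleftrightarrow> {x \<in> Field r. lev x = j} \<subseteq> snd ` A"

lemma Partial_order_r: "Partial_order r"
proof -
  have "\<forall>x\<in>Field r. (x, x) \<in> r"
    using r_iff by blast
  moreover have "antisym r"
    by (rule antisymI) (metis r_iff less_asym)
  moreover have "trans r"
    by (rule transI) (metis r_iff less_trans)
  ultimately show ?thesis unfolding Partial_order_iff by blast
qed

lemma Partial_order_P: "Partial_order P"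
  by (intro Partial_order_prod_order Partial_order_chain_order Partial_order_r)

lemma Field_P: "Field P = {1..m} \<times> Field r"
  using Field_prod_order[OF Partial_order_chain_order[THEN Refl_if_Partial_order]
      Partial_order_r[THEN Refl_if_Partial_order]]
  unfolding Field_chain_order .

lemma finite_Field_P: "finite (Field P)"
  by (simp add: Field_P finite_Field)

lemma P_iff: "((i, x), (j, y)) \<in> P \<longleftrightarrow>
    1 \<le> i \<and> i \<le> j \<and> j \<le> m \<and> x \<in> Field r \<and> y \<in> Field r \<and> (x = y \<or> lev x < lev y)"
  using r_iff[of x y] by (auto simp: chain_order_def prod_order_iff)

lemma lev_bounds: "x \<in> Field r \<Longrightarrow> 1 \<le> lev x \<and> lev x \<le> N"
  using lev_image by auto

lemma ex_level: "1 \<le> j \<Longrightarrow> j \<le> N \<Longrightarrow> \<exists>x\<in>Field r. lev x = j"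
  using lev_image by (metis atLeastAtMost_iff imageE)

section \<open>Heights of the ideal in the fibres\<close>

lemma ideal_down:
  assumes "b \<in> generated_ideal P A" "(a, b) \<in> P"
  shows "a \<in> generated_ideal P A"
proof -
  obtain c where "c \<in> A" "(b, c) \<in> P" using assms unfolding generated_ideal_def by blast
  moreover from this have "(a, c) \<in> P"
    using assms(2) Partial_order_P by (meson Partial_order_iff transD)
  ultimately show ?thesis unfolding generated_ideal_def by (blast intro: FieldI1)
qed

text \<open>Down-closure makes the rows of a fibre a down-closed subset of \<open>{1..m}\<close>,
  that is \<open>{1..k}\<close>, with \<open>k\<close> its cardinality.\<close>

lemma ideal_iff:
  "(i, x) \<in> generated_ideal P A \<longleftrightarrow> x \<in> Field r \<and> 1 \<le> i \<and> i \<le> height A x"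
proof (cases "x \<in> Field r")
  case True
  define S where "S = {i. (i, x) \<in> generated_ideal P A}"
  have sub: "S \<subseteq> {1..m}" by (auto simp: S_def generated_ideal_def Field_P)
  have down: "i \<in> S" if "j \<in> S" "1 \<le> i" "i \<le> j" for i j
    using that True sub ideal_down[of "(j, x)" A "(i, x)"] by (auto simp: S_def P_iff)
  obtain k where k: "S = {1..k}"
  proof (cases "S = {}")
    case True
    then show ?thesis using that[of 0] by simp
  next
    case False
    have fin: "finite S" using sub finite_subset by blast
    have "S = {1..Max S}"
      using down[OF Max_in[OF fin False]] Max_ge[OF fin] sub by fastforce
    then show ?thesis by (rule that)
  qed
  then have "height A x = k" by (simp add: height_def S_def)
  moreover have "(i, x) \<in> generated_ideal P A \<longleftrightarrow> i \<in> S" by (simp add: S_def)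
  ultimately show ?thesis using True k by simp
qed (auto simp: generated_ideal_def Field_P)

lemma height_le: "x \<in> Field r \<Longrightarrow> height A x \<le> m"
  using ideal_iff[of "height A x" x A] by (cases "height A x = 0") (auto simp: generated_ideal_def Field_P)

lemma height_antimono:
  assumes "x \<in> Field r" "y \<in> Field r" "lev x < lev y"
  shows "height A y \<le> height A x"
proof (cases "height A y = 0")
  case False
  then have "(height A y, y) \<in> generated_ideal P A" using assms ideal_iff by simp
  then have "(height A y, x) \<in> generated_ideal P A"
    by (rule ideal_down) (use assms False height_le[of y A] in \<open>auto simp: P_iff\<close>)
  then show ?thesis using ideal_iff by blast
qed simp

text \<open>An antichain is the set of maximal elements of its ideal, and \<open>(i, x)\<close> is
  maximal there iff it tops its own fibre and no higher fibre reaches row \<open>i\<close>.\<close>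

lemma antichain_iff:
  assumes A: "A \<in> antichains P"
  shows "(i, x) \<in> A \<longleftrightarrow> x \<in> Field r \<and> 1 \<le> i \<and> i = height A x \<and>
    (\<forall>y\<in>Field r. lev x < lev y \<longrightarrow> height A y < i)" (is "?L \<longleftrightarrow> ?R")
proof
  have AF: "A \<subseteq> Field P" and anti: "\<And>a b. a \<in> A \<Longrightarrow> b \<in> A \<Longrightarrow> (a, b) \<in> P \<Longrightarrow> a = b"
    using A by (auto simp: antichains_def)
  have A_ideal: "A \<subseteq> generated_ideal P A"
    using AF Partial_order_P by (auto simp: generated_ideal_def Partial_order_iff)
  have maximal: "a = b" if "a \<in> A" "b \<in> generated_ideal P A" "(a, b) \<in> P" for a b
  proof -
    have "\<exists>c\<in>A. (b, c) \<in> P" using that unfolding generated_ideal_def by blast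
    then obtain c where c: "c \<in> A" "(b, c) \<in> P" by blast
    then have "(a, c) \<in> P" using that Partial_order_P by (meson Partial_order_iff transD)
    then have "a = c" using anti that c by blast
    moreover have "antisym P" using Partial_order_P by (simp add: Partial_order_iff)
    ultimately show ?thesis using that c by (metis antisymD)
  qed
  {
    assume L: ?L
    then have ix: "x \<in> Field r" "1 \<le> i" "i \<le> height A x"
      using A_ideal ideal_iff by auto
    have "(i, x) = (height A x, x)"
      using ix L height_le[OF ix(1)] by (intro maximal) (auto simp: ideal_iff P_iff)
    moreover have "height A y < i" if "y \<in> Field r" "lev x < lev y" for y
    proof (rule ccontr)
      assume "\<not> height A y < i"
      then have "(i, x) = (i, y)"
        using ix L that height_le[OF ix(1), of A] by (intro maximal) (auto simp: ideal_iff P_iff)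
      then show False using that by simp
    qed
    ultimately show ?R using ix by auto
  next
    assume R: ?R
    then have "(i, x) \<in> generated_ideal P A" by (simp add: ideal_iff)
    then obtain j y where y: "(j, y) \<in> A" "((i, x), (j, y)) \<in> P"
      by (auto simp: generated_ideal_def)
    then have j: "j \<le> height A y" "y \<in> Field r" "i \<le> j" "x = y \<or> lev x < lev y"
      using A_ideal ideal_iff by (auto simp: P_iff)
    \<comment> \<open>A generator in a higher fibre would give
      \<open>i \<le> j \<le> height A y < i\<close>.\<close>
    then have "x = y" using R by fastforce
    then show ?L using R j y by auto
  }
qed

text \<open>Outside the ideal, \<open>(i, x)\<close> is minimal iff it is the first missing row of
  its fibre and no lower fibre misses row \<open>i\<close>. Only the ideal of \<open>A\<close>
  enters.\<close>

lemma reverse_op_iff: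
  "(i, x) \<in> reverse_op P A \<longleftrightarrow> x \<in> Field r \<and> i = Suc (height A x) \<and> i \<le> m \<and>
    (\<forall>y\<in>Field r. lev y < lev x \<longrightarrow> i \<le> height A y)" (is "?L \<longleftrightarrow> ?R")
proof
  have compl: "(j, y) \<in> Field P - generated_ideal P A \<longleftrightarrow> y \<in> Field r \<and> height A y < j \<and> j \<le> m"
    for j y by (auto simp: Field_P ideal_iff)
  {
    assume L: ?L
    then have ix: "x \<in> Field r" "height A x < i" "i \<le> m"
      using compl by (auto simp: reverse_op_def minimals_def)
    have minimal: "(j, y) = (i, x)"
      if "y \<in> Field r" "height A y < j" "j \<le> i" "y = x \<or> lev y < lev x" for j y
    proof -
      have "(j, y) \<in> Field P - generated_ideal P A" "((j, y), (i, x)) \<in> P"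
        using that ix unfolding compl P_iff by auto
      then show ?thesis using L unfolding reverse_op_def minimals_def by blast
    qed
    have "Suc (height A x) = i" using minimal[of x "Suc (height A x)"] ix by auto
    moreover have "i \<le> height A y" if "y \<in> Field r" "lev y < lev x" for y
      using minimal[of y i] that by (cases "height A y < i") auto
    ultimately show ?R using ix by auto
  next
    assume R: ?R
    have "(j, y) = (i, x)"
      if "(j, y) \<in> Field P - generated_ideal P A" "((j, y), (i, x)) \<in> P" for j y
      using that R unfolding compl P_iff by fastforce
    moreover have "(i, x) \<in> Field P - generated_ideal P A" using R unfolding compl by auto
    ultimately show ?L unfolding reverse_op_def minimals_def by auto
  }
qed

section \<open>Occupied rows and full levels\<close>

text \<open>Among the fibres of height \<open>i\<close>, one of largest level has only smaller
  heights above it, so its top belongs to \<open>A\<close>.\<close>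

lemma row_iff:
  assumes A: "A \<in> antichains P"
  shows "i \<in> fst ` A \<longleftrightarrow> 1 \<le> i \<and> i \<in> height A ` Field r"
proof
  assume "i \<in> fst ` A"
  then show "1 \<le> i \<and> i \<in> height A ` Field r" by (auto simp: antichain_iff[OF A])
next
  assume i: "1 \<le> i \<and> i \<in> height A ` Field r"
  let ?S = "{x \<in> Field r. height A x = i}"
  define l where "l = Max (lev ` ?S)"
  have "l \<in> lev ` ?S"
    unfolding l_def using i finite_Field by (intro Max_in) auto
  then obtain x where x: "x \<in> ?S" "lev x = l" by blast
  have max: "lev y \<le> lev x" if "y \<in> ?S" for y
    using that finite_Field unfolding x(2) l_def by (intro Max_ge) auto
  have "height A y < i" if "y \<in> Field r" "lev x < lev y" for y
    using that x max[of y] height_antimono[of x y A] by force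
  then have "(i, x) \<in> A" using x i by (auto simp: antichain_iff[OF A])
  then show "i \<in> fst ` A" by force
qed

text \<open>Dually, a fibre of smallest level among those of height \<open>i - 1\<close> has only
  larger heights below it. Height \<open>0\<close> is allowed here and accounts for row
  \<open>1\<close>.\<close>

lemma row_reverse_op_iff:
  "i \<in> fst ` reverse_op P A \<longleftrightarrow> 1 \<le> i \<and> i \<le> m \<and> i - 1 \<in> height A ` Field r"
proof
  assume "i \<in> fst ` reverse_op P A"
  then show "1 \<le> i \<and> i \<le> m \<and> i - 1 \<in> height A ` Field r" by (auto simp: reverse_op_iff)
next
  assume i: "1 \<le> i \<and> i \<le> m \<and> i - 1 \<in> height A ` Field r"
  let ?S = "{x \<in> Field r. height A x = i - 1}"
  define l where "l = Min (lev ` ?S)"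
  have "l \<in> lev ` ?S"
    unfolding l_def using i finite_Field by (intro Min_in) auto
  then obtain x where x: "x \<in> ?S" "lev x = l" by blast
  have min: "lev x \<le> lev y" if "y \<in> ?S" for y
    using that finite_Field unfolding x(2) l_def by (intro Min_le) auto
  have "i \<le> height A y" if "y \<in> Field r" "lev y < lev x" for y
    using that x min[of y] height_antimono[of y x A] by force
  then have "(i, x) \<in> reverse_op P A" using x i by (auto simp: reverse_op_iff)
  then show "i \<in> fst ` reverse_op P A" by force
qed

lemma snd_image_iff:
  assumes "A \<in> antichains P"
  shows "x \<in> snd ` A \<longleftrightarrow> x \<in> Field r \<and> 0 < height A x \<and>
    (\<forall>y\<in>Field r. lev x < lev y \<longrightarrow> height A y < height A x)"
proof -
  have "x \<in> snd ` A \<longleftrightarrow> (\<exists>i. (i, x) \<in> A)" by force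
  then show ?thesis by (auto simp: antichain_iff[OF assms])
qed

lemma snd_image_reverse_op_iff:
  "x \<in> snd ` reverse_op P A \<longleftrightarrow> x \<in> Field r \<and> height A x < m \<and>
    (\<forall>y\<in>Field r. lev y < lev x \<longrightarrow> height A x < height A y)"
proof -
  have "x \<in> snd ` reverse_op P A \<longleftrightarrow> (\<exists>i. (i, x) \<in> reverse_op P A)" by force
  then show ?thesis by (auto simp: reverse_op_iff Suc_le_eq)
qed

lemma full_iff:
  assumes A: "A \<in> antichains P"
  shows "full A j \<longleftrightarrow> (\<forall>x\<in>Field r. lev x = j \<longrightarrow>
    0 < height A x \<and> (\<forall>y\<in>Field r. lev x < lev y \<longrightarrow> height A y < height A x))"
  unfolding full_def by (auto simp: subset_iff snd_image_iff[OF A])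

lemma full_reverse_op_iff:
  "full (reverse_op P A) j \<longleftrightarrow> (\<forall>x\<in>Field r. lev x = j \<longrightarrow>
    height A x < m \<and> (\<forall>y\<in>Field r. lev y < lev x \<longrightarrow> height A x < height A y))"
  unfolding full_def by (auto simp: subset_iff snd_image_reverse_op_iff)

lemma row_Suc:
  assumes "A \<in> antichains P" "1 \<le> i" "i < m"
  shows "Suc i \<in> fst ` reverse_op P A \<longleftrightarrow> i \<in> fst ` A"
  using assms by (auto simp: row_iff row_reverse_op_iff)

text \<open>Both sides reduce to \<open>?gap\<close>, since antitone heights allow the comparison
  with all higher, respectively lower, levels to be made with the adjacent level alone.\<close>

lemma full_Suc:
  assumes "A \<in> antichains P" "1 \<le> j" "j < N"
  shows "full (reverse_op P A) (Suc j) \<longleftrightarrow> full A j"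
proof -
  obtain x0 y0 where x0: "x0 \<in> Field r" "lev x0 = j" and y0: "y0 \<in> Field r" "lev y0 = Suc j"
    using ex_level[of j] ex_level[of "Suc j"] assms by auto
  let ?gap = "\<forall>x\<in>Field r. \<forall>y\<in>Field r. lev x = j \<longrightarrow> lev y = Suc j \<longrightarrow> height A y < height A x"
  have "full A j \<longleftrightarrow> ?gap"
  proof
    assume ?gap
    have "height A y < height A x" if "x \<in> Field r" "lev x = j" "y \<in> Field r" "j < lev y" for x y
    proof -
      have "height A y \<le> height A y0 \<or> lev y = Suc j"
        using height_antimono[of y0 y A] that y0 by fastforce
      then show ?thesis using \<open>?gap\<close> that y0 by fastforce
    qed
    \<comment> \<open>Level \<open>Suc j\<close> is nonempty, so the gap also yields a positive
      height on level \<open>j\<close>.\<close>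
    then show "full A j" unfolding full_iff[OF assms(1)] using y0
      by (metis gr_zeroI lessI not_less_zero)
  qed (simp add: full_iff[OF assms(1)])
  also have "?gap \<longleftrightarrow> full (reverse_op P A) (Suc j)"
  proof
    assume ?gap
    have "height A y < height A x" if "x \<in> Field r" "lev x < Suc j" "y \<in> Field r" "lev y = Suc j"
      for x y
    proof -
      have "height A x0 \<le> height A x \<or> lev x = j"
        using height_antimono[of x x0 A] that x0 by fastforce
      then show ?thesis using \<open>?gap\<close> that x0 by fastforce
    qed
    \<comment> \<open>Level \<open>j\<close> is nonempty, so the gap also keeps the heights on level
      \<open>Suc j\<close> below \<open>m\<close>.\<close>
    then show "full (reverse_op P A) (Suc j)" unfolding full_reverse_op_iff using x0
      by (metis height_le lessI less_le_trans)
  qed (simp add: full_reverse_op_iff)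
  finally show ?thesis ..
qed

text \<open>No level lies below level \<open>1\<close>, so only the bound \<open>m\<close> on the
  heights remains. Heights are largest on level \<open>1\<close>, hence the bound says that
  \<open>m\<close> is not a height at all.\<close>

lemma full_1:
  assumes "A \<in> antichains P"
  shows "full (reverse_op P A) 1 \<longleftrightarrow> m \<notin> fst ` A"
proof -
  obtain z where z: "z \<in> Field r" "lev z = 1" using ex_level[of 1] N by auto
  have "full (reverse_op P A) 1 \<longleftrightarrow> (\<forall>x\<in>Field r. lev x = 1 \<longrightarrow> height A x < m)"
    unfolding full_reverse_op_iff using lev_bounds by fastforce
  also have "\<dots> \<longleftrightarrow> (\<forall>x\<in>Field r. height A x < m)"
  proof
    assume L: "\<forall>x\<in>Field r. lev x = 1 \<longrightarrow> height A x < m"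
    show "\<forall>x\<in>Field r. height A x < m"
    proof
      fix x assume "x \<in> Field r"
      then show "height A x < m"
        using L z lev_bounds[of x] height_antimono[of z x A] by (cases "lev x = 1") force+
    qed
  qed simp
  also have "\<dots> \<longleftrightarrow> m \<notin> height A ` Field r"
    using height_le by (force simp: le_less)
  finally show ?thesis using row_iff[OF assms] m by auto
qed

lemma finite_antichain: "A \<in> antichains P \<Longrightarrow> finite A"
  using finite_Field_P finite_subset by (auto simp: antichains_def)

section \<open>Counts over an orbit\<close>

lemma orbit_counts:
  assumes "\<O> \<subseteq> antichains P" "bij_betw (reverse_op P) \<O> \<O>"
  obtains R where "R \<le> card \<O>"
    and "(\<Sum>A\<in>\<O>. card (fst ` A)) = m * R"
    and "\<And>j. 1 \<le> j \<Longrightarrow> j \<le> N \<Longrightarrow> card {A \<in> \<O>. full A j} = card \<O> - R"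
    and "(\<Sum>A\<in>\<O>. card {j \<in> {1..N}. full A j}) = N * (card \<O> - R)"
proof -
  have fin: "finite \<O>"
    using assms(1) finite_antichains[OF finite_Field_P] finite_subset by blast
  \<comment> \<open>Row \<open>m\<close> is the one that \<open>full_1\<close> ties to level
    \<open>1\<close>. The row counts descend from it by \<open>row_Suc\<close>, the level counts
    ascend from level \<open>1\<close> by \<open>full_Suc\<close>.\<close>
  define R where "R = card {A \<in> \<O>. m \<in> fst ` A}"
  have R: "R \<le> card \<O>" unfolding R_def using fin by (intro card_mono) auto
  have not: "card {A \<in> \<O>. \<not> Q A} = card \<O> - card {A \<in> \<O>. Q A}" for Q
  proof -
    have "{A \<in> \<O>. \<not> Q A} = \<O> - {A \<in> \<O>. Q A}" by auto
    then show ?thesis using fin by (simp add: card_Diff_subset)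
  qed
  have shift: "card {A \<in> \<O>. Q A} = card {A \<in> \<O>. Q' A}"
    if "\<And>A. A \<in> antichains P \<Longrightarrow> Q (reverse_op P A) \<longleftrightarrow> Q' A" for Q Q'
    using assms that by (intro card_Collect_bij_betw) auto
  have rows: "card {A \<in> \<O>. i \<in> fst ` A} = R" if "1 \<le> i" "i \<le> m" for i
    using that(2,1)
  proof (induction rule: inc_induct)
    case (step i)
    then show ?case
      using shift[of "\<lambda>A. Suc i \<in> fst ` A" "\<lambda>A. i \<in> fst ` A"] row_Suc by simp
  qed (simp add: R_def)
  have levels: "card {A \<in> \<O>. full A j} = card \<O> - R" if "1 \<le> j" "j \<le> N" for j
    using that
  proof (induction rule: dec_induct)
    case base
    then show ?case using shift[of "\<lambda>A. full A 1", OF full_1] not unfolding R_def by simp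
  next
    case (step j)
    then show ?case
      using shift[of "\<lambda>A. full A (Suc j)" "\<lambda>A. full A j"] full_Suc by simp
  qed
  have "(\<Sum>A\<in>\<O>. card (fst ` A)) = (\<Sum>A\<in>\<O>. card {i \<in> {1..m}. i \<in> fst ` A})"
  proof (rule sum.cong[OF refl])
    fix A assume "A \<in> \<O>"
    then have "A \<subseteq> Field P" using assms(1) by (auto simp: antichains_def)
    then have "fst ` A = {i \<in> {1..m}. i \<in> fst ` A}" by (force simp: Field_P)
    then show "card (fst ` A) = card {i \<in> {1..m}. i \<in> fst ` A}" by metis
  qed
  also have "\<dots> = m * R"
    using rows by (subst sum_card_eq_card_Collect[OF fin]) simp_all
  finally have "(\<Sum>A\<in>\<O>. card (fst ` A)) = m * R" .
  moreover have "(\<Sum>A\<in>\<O>. card {j \<in> {1..N}. full A j}) = N * (card \<O> - R)"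
    using levels by (subst sum_card_eq_card_Collect[OF fin]) simp_all
  ultimately show thesis using that R levels by blast
qed

end

section \<open>One doubled level\<close>

text \<open>The twins may sit on any of the \<open>N\<close> levels; the average will depend on
  \<open>m\<close> and \<open>N\<close> only.\<close>

locale doubled_layered_order = layered_order +
  fixes p q :: 'a
  assumes pq: "p \<in> Field r" "q \<in> Field r" "p \<noteq> q" "lev p = lev q"
    and same_lev: "\<And>x y. x \<in> Field r \<Longrightarrow> y \<in> Field r \<Longrightarrow> lev x = lev y \<Longrightarrow> x \<noteq> y \<Longrightarrow>
      {x, y} = {p, q}"
begin

text \<open>Fibres above the twins are no higher than the lower twin \<open>y\<close>, hence
  strictly lower than \<open>x\<close>. The form \<open>{x, y} = {p, q}\<close> covers both
  labellings.\<close>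

lemma higher_twin_in_antichain:
  assumes A: "A \<in> antichains P" and "{x, y} = {p, q}" "height A y < height A x"
  shows "x \<in> snd ` A"
proof -
  have xy: "x \<in> Field r" "y \<in> Field r" "lev x = lev y"
    using assms(2) pq by (auto simp: doubleton_eq_iff)
  have "height A z < height A x" if "z \<in> Field r" "lev x < lev z" for z
    using height_antimono[of y z A] that xy assms(3) by simp
  then show ?thesis using xy assms(3) by (simp add: snd_image_iff[OF A])
qed

lemma lower_twin_in_reverse_op:
  assumes "{x, y} = {p, q}" "height A x < height A y"
  shows "x \<in> snd ` reverse_op P A"
proof -
  have xy: "x \<in> Field r" "y \<in> Field r" "lev x = lev y"
    using assms(1) pq by (auto simp: doubleton_eq_iff)
  have "height A x < height A z" if "z \<in> Field r" "lev z < lev x" for z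
    using height_antimono[of z y A] that xy assms(2) by simp
  moreover have "height A x < m" using height_le[OF xy(2), of A] assms(2) by simp
  ultimately show ?thesis using xy by (simp add: snd_image_reverse_op_iff)
qed

text \<open>If the heights differ, the higher twin is hit by \<open>A\<close>, in a row that the
  other cannot share. With the analogue for \<open>reverse_op P A\<close>, equality of the twin
  heights becomes the symmetry of an antichain under exchange of the twins, which gives
  invariance.\<close>

lemma height_eq_iff:
  assumes A: "A \<in> antichains P"
  shows "height A p = height A q \<longleftrightarrow> (\<forall>i. (i, p) \<in> A \<longleftrightarrow> (i, q) \<in> A)"
proof
  assume "height A p = height A q"
  then show "\<forall>i. (i, p) \<in> A \<longleftrightarrow> (i, q) \<in> A" using pq by (simp add: antichain_iff[OF A])
next
  assume sym: "\<forall>i. (i, p) \<in> A \<longleftrightarrow> (i, q) \<in> A"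
  show "height A p = height A q"
  proof (rule ccontr)
    assume "height A p \<noteq> height A q"
    then have "p \<in> snd ` A \<or> q \<in> snd ` A"
      using higher_twin_in_antichain[OF A, of p q] higher_twin_in_antichain[OF A, of q p]
      by (metis insert_commute linorder_neqE_nat)
    then obtain i where "(i, p) \<in> A" "(i, q) \<in> A" using sym by force
    then show False using \<open>height A p \<noteq> height A q\<close> by (simp add: antichain_iff[OF A])
  qed
qed

lemma height_eq_iff_reverse_op:
  "height A p = height A q \<longleftrightarrow> (\<forall>i. (i, p) \<in> reverse_op P A \<longleftrightarrow> (i, q) \<in> reverse_op P A)"
proof
  assume "height A p = height A q"
  then show "\<forall>i. (i, p) \<in> reverse_op P A \<longleftrightarrow> (i, q) \<in> reverse_op P A"
    using pq by (simp add: reverse_op_iff)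
next
  assume sym: "\<forall>i. (i, p) \<in> reverse_op P A \<longleftrightarrow> (i, q) \<in> reverse_op P A"
  show "height A p = height A q"
  proof (rule ccontr)
    assume "height A p \<noteq> height A q"
    then have "p \<in> snd ` reverse_op P A \<or> q \<in> snd ` reverse_op P A"
      using lower_twin_in_reverse_op[of p q] lower_twin_in_reverse_op[of q p]
      by (metis insert_commute linorder_neqE_nat)
    then obtain i where "(i, p) \<in> reverse_op P A" "(i, q) \<in> reverse_op P A" using sym by force
    then show False using \<open>height A p \<noteq> height A q\<close> by (simp add: reverse_op_iff)
  qed
qed

lemma height_eq_invariant:
  assumes "A \<in> antichains P"
  shows "height (reverse_op P A) p = height (reverse_op P A) q \<longleftrightarrow> height A p = height A q"
  using height_eq_iff[OF reverse_op_antichain] height_eq_iff_reverse_op by simp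

lemma card_snd_image:
  assumes "A \<in> antichains P"
  shows "card (snd ` A) = card A"
proof (rule card_image, rule inj_onI)
  fix a b assume "a \<in> A" "b \<in> A" "snd a = snd b"
  then show "a = b" by (cases a; cases b) (simp add: antichain_iff[OF assms])
qed

lemma fst_image_eq:
  assumes "A \<in> antichains P"
  shows "fst ` A = height A ` snd ` A"
  unfolding image_image by (rule image_cong) (auto simp: antichain_iff[OF assms])

text \<open>Without \<open>x\<close> each level holds at most one hit element. By \<open>imp\<close>
  a hit \<open>y\<close> forces a hit \<open>x\<close>, so a level keeps a hit element exactly when
  it is full. This serves with \<open>x = q\<close> for equal heights and with \<open>x\<close> the
  higher twin otherwise.\<close>

lemma card_full:
  assumes A: "A \<in> antichains P" and xy: "{x, y} = {p, q}"
    and imp: "y \<in> snd ` A \<Longrightarrow> x \<in> snd ` A"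
  shows "card (snd ` A - {x}) = card {j \<in> {1..N}. full A j}"
proof -
  have F: "snd ` A \<subseteq> Field r" using snd_image_iff[OF A] by blast
  have xy': "x \<in> Field r" "y \<in> Field r" "lev x = lev y" "x \<noteq> y"
    using xy pq by (auto simp: doubleton_eq_iff)
  have twin: "u = v \<or> u = x \<or> v = x" "u = v \<or> {u, v} = {x, y}"
    if "u \<in> Field r" "v \<in> Field r" "lev u = lev v" for u v
    using same_lev[OF that] xy by (auto simp: doubleton_eq_iff)
  have "inj_on lev (snd ` A - {x})"
    using twin(1) F by (intro inj_onI) blast
  moreover have "lev ` (snd ` A - {x}) = {j \<in> {1..N}. full A j}"
  proof (intro equalityI subsetI)
    fix j assume "j \<in> lev ` (snd ` A - {x})"
    then obtain u where u: "u \<in> snd ` A" "u \<noteq> x" "j = lev u" by blast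
    have "v \<in> snd ` A" if "v \<in> Field r" "lev v = j" for v
      using twin(2)[of u v] that u F imp by (auto simp: doubleton_eq_iff)
    then show "j \<in> {j \<in> {1..N}. full A j}"
      using u F lev_bounds[of u] by (auto simp: full_def)
  next
    fix j assume j: "j \<in> {j \<in> {1..N}. full A j}"
    then obtain u where "u \<in> Field r" "lev u = j" using ex_level by auto
    \<comment> \<open>The level of \<open>x\<close> also contains \<open>y\<close>.\<close>
    then obtain v where "v \<in> Field r" "lev v = j" "v \<noteq> x" using xy' by (cases "u = x") auto
    then show "j \<in> lev ` (snd ` A - {x})" using j unfolding full_def by blast
  qed
  ultimately show ?thesis by (metis card_image)
qed

text \<open>Of two hit elements on different levels, the upper one has strictly smaller
  height.\<close>

lemma height_inj:
  assumes A: "A \<in> antichains P" and "x \<in> snd ` A" "y \<in> snd ` A" "height A x = height A y"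
  shows "x = y \<or> {x, y} = {p, q}"
proof -
  have "lev x = lev y"
    using assms snd_image_iff[OF A] by (metis less_irrefl linorder_neqE_nat)
  then show ?thesis using assms snd_image_iff[OF A] same_lev by blast
qed

text \<open>The twins are hit together or not at all. Dropping \<open>q\<close> loses no row,
  because \<open>p\<close> has the same height, and makes \<open>height A\<close> injective;
  \<open>q\<close> itself is the extra element of a full twin level.\<close>

lemma card_balanced:
  assumes A: "A \<in> antichains P" and eq: "height A p = height A q"
  shows "card (fst ` A) = card {j \<in> {1..N}. full A j}"
    and "card A = card {j \<in> {1..N}. full A j} + (if full A (lev p) then 1 else 0)"
proof -
  have pq_iff: "p \<in> snd ` A \<longleftrightarrow> q \<in> snd ` A"
    using eq pq by (simp add: snd_image_iff[OF A])
  have full: "card (snd ` A - {q}) = card {j \<in> {1..N}. full A j}"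
    using pq_iff by (intro card_full[OF A, of q p]) auto
  have "inj_on (height A) (snd ` A - {q})"
    using height_inj[OF A] by (intro inj_onI) (metis DiffD1 DiffD2 doubleton_eq_iff singletonI)
  moreover have "height A ` (snd ` A - {q}) = height A ` snd ` A"
  proof (intro equalityI subsetI)
    fix i assume "i \<in> height A ` snd ` A"
    then obtain x where x: "x \<in> snd ` A" "i = height A x" by blast
    have "\<exists>y\<in>snd ` A - {q}. i = height A y"
    proof (cases "x = q")
      case True
      then have "p \<in> snd ` A - {q}" "i = height A p" using x eq pq(3) pq_iff by simp_all
      then show ?thesis by (rule bexI[rotated])
    qed (use x in blast)
    then show "i \<in> height A ` (snd ` A - {q})" by blast
  qed blast
  ultimately show "card (fst ` A) = card {j \<in> {1..N}. full A j}"
    unfolding fst_image_eq[OF A] full[symmetric] by (metis card_image)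
  have "full A (lev p) \<longleftrightarrow> q \<in> snd ` A"
  proof
    assume "full A (lev p)"
    then show "q \<in> snd ` A" using pq by (auto simp: full_def)
  next
    assume "q \<in> snd ` A"
    then have "x \<in> snd ` A" if "x \<in> Field r" "lev x = lev p" for x
      using same_lev[of x p] that pq pq_iff by (cases "x = p") (auto simp: doubleton_eq_iff)
    then show "full A (lev p)" by (auto simp: full_def)
  qed
  moreover have "finite (snd ` A)" using finite_antichain[OF A] by simp
  ultimately show "card A = card {j \<in> {1..N}. full A j} + (if full A (lev p) then 1 else 0)"
    unfolding card_snd_image[OF A, symmetric] full[symmetric]
    using card.remove[of "snd ` A" q] by simp
qed

text \<open>Distinct twin heights make \<open>height A\<close> injective on the hit elements. The
  higher twin is always hit and is the one element that \<open>card_full\<close> leaves out.\<close>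

lemma card_unbalanced:
  assumes A: "A \<in> antichains P" and neq: "height A p \<noteq> height A q"
  shows "card A = card (fst ` A)"
    and "card A = card {j \<in> {1..N}. full A j} + 1"
proof -
  have "inj_on (height A) (snd ` A)"
    using height_inj[OF A] neq by (intro inj_onI) (metis doubleton_eq_iff)
  then show "card A = card (fst ` A)"
    unfolding fst_image_eq[OF A] by (simp add: card_image card_snd_image[OF A])
  obtain x y where xy: "{x, y} = {p, q}" "height A y < height A x"
    using neq by (metis insert_commute linorder_neqE_nat)
  then have x: "x \<in> snd ` A" by (rule higher_twin_in_antichain[OF A])
  have "finite (snd ` A)" using finite_antichain[OF A] by simp
  then show "card A = card {j \<in> {1..N}. full A j} + 1"
    using card_full[OF A xy(1)] x card.remove[of "snd ` A" x] card_snd_image[OF A] by simp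
qed

lemma sum_card_orbit:
  assumes "\<O> \<in> cyclic_orbits (reverse_op P) (antichains P)"
  shows "card \<O> > 0" and "(m + N) * (\<Sum>A\<in>\<O>. card A) = m * (N + 1) * card \<O>"
proof -
  have finS: "finite (antichains P)" using finite_antichains[OF finite_Field_P] .
  note orbit = cyclic_orbit_properties[OF finS reverse_op_bij[OF Partial_order_P finite_Field_P] assms]
  have fin: "finite \<O>" using orbit(1) finS finite_subset by blast
  then show "card \<O> > 0" using orbit(2) by (simp add: card_gt_0_iff)
  obtain R where R: "R \<le> card \<O>" "(\<Sum>A\<in>\<O>. card (fst ` A)) = m * R"
    "\<And>j. 1 \<le> j \<Longrightarrow> j \<le> N \<Longrightarrow> card {A \<in> \<O>. full A j} = card \<O> - R"
    "(\<Sum>A\<in>\<O>. card {j \<in> {1..N}. full A j}) = N * (card \<O> - R)"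
    using orbit_counts[OF orbit(1,3)] by blast
  \<comment> \<open>\<open>C\<close> is the number of antichains of the orbit in which a given level
    is full.\<close>
  obtain C where C: "card \<O> = R + C" using R(1) le_Suc_ex by blast
  obtain A0 where A0: "A0 \<in> \<O>" using orbit(2) by blast
  have inv: "\<forall>A\<in>\<O>. height A p = height A q \<longleftrightarrow> height A0 p = height A0 q"
    by (rule orbit(4)[OF A0]) (rule height_eq_invariant)
  show "(m + N) * (\<Sum>A\<in>\<O>. card A) = m * (N + 1) * card \<O>"
  proof (cases "height A0 p = height A0 q")
    case True
    then have bal: "A \<in> antichains P" "height A p = height A q" if "A \<in> \<O>" for A
      using inv orbit(1) that by auto
    have "m * R = N * C"
      using R(2,4) card_balanced(1)[OF bal] C by simp
    moreover have "(\<Sum>A\<in>\<O>. card A) = N * C + card {A \<in> \<O>. full A (lev p)}"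
    proof -
      have "(\<Sum>A\<in>\<O>. card A) =
          (\<Sum>A\<in>\<O>. card {j \<in> {1..N}. full A j} + (if full A (lev p) then 1 else 0))"
        by (rule sum.cong[OF refl]) (rule card_balanced(2)[OF bal])
      then show ?thesis
        using R(4) C fin by (simp add: sum.distrib sum.If_cases Int_def)
    qed
    moreover have "card {A \<in> \<O>. full A (lev p)} = C"
      using R(3)[of "lev p"] lev_bounds[OF pq(1)] C by simp
    \<comment> \<open>With \<open>m * R = N * C\<close> the right-hand side is
      \<open>(m + N) * (N + 1) * C\<close>, and the sum of the sizes is
      \<open>(N + 1) * C\<close>.\<close>
    moreover have "m * (N + 1) * (R + C) = (N + 1) * (m * R) + m * (N + 1) * C"
      by (simp add: algebra_simps)
    ultimately show ?thesis unfolding C by (simp add: algebra_simps)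
  next
    case False
    then have unbal: "A \<in> antichains P" "height A p \<noteq> height A q" if "A \<in> \<O>" for A
      using inv orbit(1) that by auto
    have rows: "(\<Sum>A\<in>\<O>. card A) = m * R"
      unfolding R(2)[symmetric] by (rule sum.cong[OF refl]) (rule card_unbalanced(1)[OF unbal])
    have "(\<Sum>A\<in>\<O>. card A) = (\<Sum>A\<in>\<O>. card {j \<in> {1..N}. full A j} + 1)"
      by (rule sum.cong[OF refl]) (rule card_unbalanced(2)[OF unbal])
    also have "\<dots> = N * C + (R + C)"
      using R(4) C by (simp only: sum.distrib card_eq_sum[symmetric] add_diff_cancel_left')
    finally have "(\<Sum>A\<in>\<O>. card A) = N * C + (R + C)" .
    \<comment> \<open>In \<open>(m + N)\<close> times the sum, the part with factor \<open>N\<close>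
      uses the count by rows, the part with factor \<open>m\<close> the count by levels.\<close>
    then have "m * R + N * (\<Sum>A\<in>\<O>. card A) = m * R + N * (m * R)"
      and "m * (\<Sum>A\<in>\<O>. card A) = m * (N * C + (R + C))"
      using rows by simp_all
    then show ?thesis unfolding C by (simp add: algebra_simps)
  qed
qed

end

section \<open>The levels of \<open>K_order\<close>\<close>

text \<open>The rank function of \<open>K_order (n - 1)\<close>. The parameter is the middle level,
  one more than the chain length, whence \<open>Suc k\<close> in \<open>K_order_iff\<close>.\<close>

definition K_level :: "nat \<Rightarrow> nat + ((nat + nat) + nat) \<Rightarrow> nat" where
  "K_level n = case_sum id (case_sum (\<lambda>_. n) (\<lambda>d. n + d))"

lemma K_level_simps [simp]:
  "K_level n (Inl i) = i" "K_level n (Inr (Inl c)) = n" "K_level n (Inr (Inr j)) = n + j"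
  by (simp_all add: K_level_def)

lemma Field_K_order: "Field (K_order k) =
    Inl ` {1..k} \<union> {Inr (Inl (Inl 1)), Inr (Inl (Inr 1))} \<union> (Inr \<circ> Inr) ` {1..k}"
  unfolding K_order_def Field_ordinal_sum Field_disjoint_sum Field_chain_order
  by auto

lemma Field_K_order_cases:
  assumes "x \<in> Field (K_order k)"
  obtains i where "x = Inl i" "1 \<le> i" "i \<le> k"
  | "x = Inr (Inl (Inl 1))"
  | "x = Inr (Inl (Inr 1))"
  | j where "x = Inr (Inr j)" "1 \<le> j" "j \<le> k"
  using assms unfolding Field_K_order by auto

lemma K_order_iff:
  assumes "x \<in> Field (K_order k)" "y \<in> Field (K_order k)"
  shows "(x, y) \<in> K_order k \<longleftrightarrow> x = y \<or> K_level (Suc k) x < K_level (Suc k) y"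
proof -
  have chain: "(i, j) \<in> chain_order l \<longleftrightarrow> 1 \<le> i \<and> i \<le> j \<and> j \<le> l" for i j l
    by (simp add: chain_order_def)
  show ?thesis
    by (rule Field_K_order_cases[OF assms(1)]; rule Field_K_order_cases[OF assms(2)])
      (auto simp: K_order_def chain Field_ordinal_sum Field_disjoint_sum Field_chain_order)
qed

lemma doubled_layered_order_K_order:
  assumes "m \<ge> 1" "n \<ge> 1"
  shows "doubled_layered_order m (2 * n - 1) (K_order (n - 1)) (K_level n)
    (Inr (Inl (Inl 1))) (Inr (Inl (Inr 1)))"
proof
  show "m \<ge> 1" by fact
  show "2 * n - 1 \<ge> 1" using assms by simp
  show "finite (Field (K_order (n - 1)))" by (rule finite_Field_K_order)
  show "K_level n ` Field (K_order (n - 1)) = {1..2 * n - 1}"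
  proof (intro equalityI subsetI)
    fix j assume j: "j \<in> {1..2 * n - 1}"
    consider "j < n" | "j = n" | "j > n" by linarith
    then show "j \<in> K_level n ` Field (K_order (n - 1))"
    proof cases
      case 1
      then have "Inl j \<in> Field (K_order (n - 1))" using j by (auto simp: Field_K_order)
      then show ?thesis using image_eqI[of j "K_level n" "Inl j"] by simp
    next
      case 2
      have "Inr (Inl (Inl 1)) \<in> Field (K_order (n - 1))" by (simp add: Field_K_order)
      then show ?thesis using 2 image_eqI[of j "K_level n" "Inr (Inl (Inl 1))"] by simp
    next
      case 3
      then have "j - n \<in> {1..n - 1}" using j by auto
      then have "Inr (Inr (j - n)) \<in> Field (K_order (n - 1))" unfolding Field_K_order by force
      then show ?thesis using 3 image_eqI[of j "K_level n" "Inr (Inr (j - n))"] by simp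
    qed
  next
    fix j assume "j \<in> K_level n ` Field (K_order (n - 1))"
    then obtain x where "j = K_level n x" "x \<in> Field (K_order (n - 1))" by blast
    then show "j \<in> {1..2 * n - 1}" using assms by (auto elim!: Field_K_order_cases)
  qed
  show "(x, y) \<in> K_order (n - 1) \<longleftrightarrow> x \<in> Field (K_order (n - 1)) \<and> y \<in> Field (K_order (n - 1)) \<and>
    (x = y \<or> K_level n x < K_level n y)" for x y
    using K_order_iff[of x "n - 1" y] assms by (auto intro: FieldI1 FieldI2)
  show "Inr (Inl (Inl 1)) \<in> Field (K_order (n - 1))" "Inr (Inl (Inr 1)) \<in> Field (K_order (n - 1))"
    by (simp_all add: Field_K_order)
  show "Inr (Inl (Inl 1)) \<noteq> (Inr (Inl (Inr 1)) :: nat + ((nat + nat) + nat))" by simp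
  show "K_level n (Inr (Inl (Inl 1))) = K_level n (Inr (Inl (Inr 1)))" by simp
  show "{x, y} = {Inr (Inl (Inl 1)), Inr (Inl (Inr 1))}"
    if "x \<in> Field (K_order (n - 1))" "y \<in> Field (K_order (n - 1))" "K_level n x = K_level n y"
      "x \<noteq> y" for x y
    \<comment> \<open>The lower chain has levels below \<open>n\<close> and the upper chain levels
      above \<open>n\<close>, so only the middle elements can share a level.\<close>
    by (rule Field_K_order_cases[OF that(1)]; rule Field_K_order_cases[OF that(2)])
      (use that(3,4) assms in auto)
qed

theorem theoremB:
  fixes m n :: nat
  assumes "m \<ge> 1" and "n \<ge> 1"
  defines "P \<equiv> prod_order (chain_order m) (K_order (n - 1))"
  assumes "\<O> \<in> cyclic_orbits (reverse_op P) (antichains P)"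
  shows "(\<Sum>A\<in>\<O>. real (card A)) / real (card \<O>) = 2 * real m * real n / (real m + 2 * real n - 1)"
proof -
  interpret doubled_layered_order m "2 * n - 1" "K_order (n - 1)" "K_level n"
    "Inr (Inl (Inl 1))" "Inr (Inl (Inr 1))"
    using assms(1,2) by (rule doubled_layered_order_K_order)
  have pos: "card \<O> > 0"
    and eq: "(m + (2 * n - 1)) * (\<Sum>A\<in>\<O>. card A) = m * (2 * n - 1 + 1) * card \<O>"
    using sum_card_orbit assms(4) unfolding P_def by blast+
  have "real (m + (2 * n - 1)) * real (\<Sum>A\<in>\<O>. card A) = real (m * (2 * n - 1 + 1)) * real (card \<O>)"
    unfolding of_nat_mult[symmetric] eq ..
  \<comment> \<open>Since \<open>n \<ge> 1\<close>, the natural subtraction in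
    \<open>N = 2 * n - 1\<close> is exact.\<close>
  moreover have "real (m + (2 * n - 1)) = real m + 2 * real n - 1" "2 * n - 1 + 1 = 2 * n"
    using assms(2) by simp_all
  ultimately have "(real m + 2 * real n - 1) * (\<Sum>A\<in>\<O>. real (card A)) =
      2 * real m * real n * real (card \<O>)"
    by (simp add: mult_ac)
  moreover have "real m + 2 * real n - 1 > 0" using assms(1,2) by simp
  ultimately show ?thesis using pos by (simp add: divide_simps mult.commute)
qed

end
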